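(* Let $M$ be a left-cancellative monoid with no nontrivial invertible element and let $S$ be a Garside family in $M$. Let $R$ consist of all rules $s|t\to w$ with $s,t\in S\setminus\{1\}$ such that $s|t$ is not $S$-normal, where $w$ is the minimal-length $S$-normal decomposition of the element $st$ of $M$. Then the rewriting system $(S\setminus\{1\},R)$ is convergent.
   Context: For $f,g\in M$, $f\preccurlyeq g$ means $fg'=g$ for some $g'\in M$. For $S\subseteq M$, words over $S$ are finite sequences $s_1|\cdots|s_p$ of elements of $S$. A word $s_1|s_2$ over $S$ is $S$-normal if for all $s\in S$ and $f\in M$, $s\preccurlyeq f s_1s_2$ implies $s\preccurlyeq f s_1$; a word $s_1|\cdots|s_p$ is $S$-normal if every $s_i|s_{i+1}$ is $S$-normal. For $M$ with no nontrivial invertible element and $1\in S\subseteq M$, $S$ is a Garside family in $M$ if every $g\in M$ has an $S$-normal decomposition, i.e. $g=s_1\cdots s_p$ for some $S$-normal word $s_1|\cdots|s_p$. In this case (known) each $g$ has a unique $S$-normal decomposition of minimal length, its letters lie in $S\setminus\{1\}$, and an element represented by a word over $S$ of length $p$ has minimal-length $S$-normal decomposition of length at most $p$. A rewriting system $(X,R)$ is a set $X$ with a set $R$ of rules $w\to w'$ between words over $X$; $\to_R$ is the relation $u|w|v\to_R u|w'|v$ for words $u,v$ and $w\to w'$ in $R$; $\to_R^*$ is its reflexive-transitive closure. It is confluent if $w\to_R^*w_1$, $w\to_R^*w_2$ imply $w_1\to_R^*w'$, $w_2\to_R^*w'$ for some $w'$; it terminates if there is no infinite sequence of $\to_R$-steps;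 convergent means confluent and terminating. *)

theory Defs
  imports Main "HOL-Library.Confluence"
begin

definition left_cancellative :: "'a::monoid_mult itself \<Rightarrow> bool" where
  "left_cancellative _ \<longleftrightarrow> (\<forall>f g h :: 'a. f * g = f * h \<longrightarrow> g = h)"

definition no_nontrivial_invertible :: "'a::monoid_mult itself \<Rightarrow> bool" where
  "no_nontrivial_invertible _ \<longleftrightarrow> (\<forall>f g :: 'a. f * g = 1 \<and> g * f = 1 \<longrightarrow> f = 1)"

text \<open>
  Words over \<open>S\<close> are the elements of \<open>lists S\<close>, and the word \<open>w\<close> represents the element
  \<open>prod_list w\<close>. The class \<open>monoid_mult\<close> is not a subclass of \<open>dvd\<close>, hence a separate
  left-divisibility relation.
\<close>

definition left_divides :: "'a::monoid_mult \<Rightarrow> 'a \<Rightarrow> bool" (infix "\<preceq>\<^sub>l" 50) where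
  "f \<preceq>\<^sub>l g \<longleftrightarrow> (\<exists>g'. f * g' = g)"

definition normal_pair :: "'a::monoid_mult set \<Rightarrow> 'a \<Rightarrow> 'a \<Rightarrow> bool" where
  "normal_pair S s1 s2 \<longleftrightarrow> (\<forall>s\<in>S. \<forall>f. s \<preceq>\<^sub>l f * s1 * s2 \<longrightarrow> s \<preceq>\<^sub>l f * s1)"

definition normal_word :: "'a::monoid_mult set \<Rightarrow> 'a list \<Rightarrow> bool" where
  "normal_word S w \<longleftrightarrow> w \<in> lists S \<and> successively (normal_pair S) w"

definition normal_decomposition :: "'a::monoid_mult set \<Rightarrow> 'a \<Rightarrow> 'a list \<Rightarrow> bool" where
  "normal_decomposition S g w \<longleftrightarrow> normal_word S w \<and> prod_list w = g"

definition garside_family :: "'a::monoid_mult set \<Rightarrow> bool" where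
  "garside_family S \<longleftrightarrow> 1 \<in> S \<and> (\<forall>g. \<exists>w. normal_decomposition S g w)"

definition minimal_normal_decomposition :: "'a::monoid_mult set \<Rightarrow> 'a \<Rightarrow> 'a list \<Rightarrow> bool" where
  "minimal_normal_decomposition S g w \<longleftrightarrow>
     normal_decomposition S g w \<and> (\<forall>v. normal_decomposition S g v \<longrightarrow> length w \<le> length v)"

definition garside_rules :: "'a::monoid_mult set \<Rightarrow> ('a list \<times> 'a list) set" where
  "garside_rules S =
     {([s, t], w) | s t w. s \<in> S - {1} \<and> t \<in> S - {1} \<and> \<not> normal_word S [s, t] \<and>
                           minimal_normal_decomposition S (s * t) w}"

definition rewriting_system :: "'a set \<Rightarrow> ('a list \<times> 'a list) set \<Rightarrow> bool" where
  "rewriting_system X R \<longleftrightarrow> R \<subseteq> lists X \<times> lists X"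

inductive rewrite_step :: "'a set \<Rightarrow> ('a list \<times> 'a list) set \<Rightarrow> 'a list \<Rightarrow> 'a list \<Rightarrow> bool"
  for X R where
  "\<lbrakk>u \<in> lists X; v \<in> lists X; (w, w') \<in> R\<rbrakk> \<Longrightarrow> rewrite_step X R (u @ w @ v) (u @ w' @ v)"

definition terminating :: "'a set \<Rightarrow> ('a list \<times> 'a list) set \<Rightarrow> bool" where
  "terminating X R \<longleftrightarrow> \<not> (\<exists>f :: nat \<Rightarrow> 'a list. \<forall>i. rewrite_step X R (f i) (f (Suc i)))"

text \<open>
  \<open>confluentp\<close> ranges over all lists, but for a rewriting system over \<open>X\<close> a list containing a
  letter outside \<open>X\<close> takes no step, so only the words over \<open>X\<close> matter.
\<close>

definition convergent_rewriting_system :: "'a set \<Rightarrow> ('a list \<times> 'a list) set \<Rightarrow> bool" where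
  "convergent_rewriting_system X R \<longleftrightarrow>
     rewriting_system X R \<and> confluentp (rewrite_step X R) \<and> terminating X R"

end

theory Submission
  imports Defs
begin

text \<open>
  Irreducible words over \<open>S - {1}\<close> are the normal words without the letter \<open>1\<close>, and such a word
  is determined by its product; since rewriting preserves products, confluence follows from
  termination. Right-hand sides have length at most two, so an infinite rewriting sequence would
  eventually have constant length. For such a sequence let \<open>P\<^sub>k\<close> be the product of the first \<open>k\<close>
  letters and \<open>D\<^sub>k\<close> the set of pairs \<open>(s, f)\<close> with \<open>s \<in> S\<close> and \<open>s \<preceq>\<^sub>l f * P\<^sub>k\<close>. A step at
  position \<open>k\<close> changes no other \<open>P\<^sub>i\<close>, can only enlarge \<open>D\<^sub>k\<close>, and makes it equal to \<open>D\<^bsub>k+1\<^esub>\<close>. By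
  downward induction on \<open>k\<close>, each \<open>D\<^sub>k\<close> is eventually constant. But a step at the first position
  strictly enlarges \<open>D\<^sub>1\<close>, so eventually the first letter is fixed and can be dropped.
\<close>

section \<open>Left divisibility and domination\<close>

lemma left_divides_refl [simp]: "a \<preceq>\<^sub>l (a::'a::monoid_mult)"
  unfolding left_divides_def by (rule exI[of _ 1]) simp

lemma left_divides_one [simp]: "1 \<preceq>\<^sub>l (a::'a::monoid_mult)"
  unfolding left_divides_def by simp

lemma left_divides_mult_right [simp]: "a \<preceq>\<^sub>l a * (b::'a::monoid_mult)"
  unfolding left_divides_def by blast

lemma left_divides_trans:
  "a \<preceq>\<^sub>l b \<Longrightarrow> b \<preceq>\<^sub>l c \<Longrightarrow> a \<preceq>\<^sub>l (c::'a::monoid_mult)"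
  unfolding left_divides_def by (metis mult.assoc)

lemma left_divides_mult_left: "a \<preceq>\<^sub>l b \<Longrightarrow> c * a \<preceq>\<^sub>l c * (b::'a::monoid_mult)"
  unfolding left_divides_def by (metis mult.assoc)

lemma prod_list_take_left_divides:
  "i \<le> j \<Longrightarrow> prod_list (take i w) \<preceq>\<^sub>l prod_list (take j (w::'a::monoid_mult list))"
  by (metis le_add_diff_inverse left_divides_mult_right prod_list.append take_add)

text \<open>This is the inclusion of the set \<open>D\<close> of pairs \<open>(s, f)\<close>
  attached to \<open>b\<close> in the one attached to \<open>a\<close>. Letting \<open>f\<close>
  vary makes it stable under left multiplication.\<close>

definition dominates :: "'a::monoid_mult set \<Rightarrow> 'a \<Rightarrow> 'a \<Rightarrow> bool" where
  "dominates S a b \<longleftrightarrow> (\<forall>s\<in>S. \<forall>f. s \<preceq>\<^sub>l f * b \<longrightarrow> s \<preceq>\<^sub>l f * a)"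

lemma normal_pair_iff_dominates: "normal_pair S s t \<longleftrightarrow> dominates S s (s * t)"
  unfolding normal_pair_def dominates_def by (simp add: mult.assoc)

lemma dominates_refl [simp]: "dominates S a a"
  unfolding dominates_def by blast

lemma dominates_trans: "dominates S a b \<Longrightarrow> dominates S b c \<Longrightarrow> dominates S a c"
  unfolding dominates_def by blast

lemma left_divides_imp_dominates: "b \<preceq>\<^sub>l a \<Longrightarrow> dominates S a b"
  unfolding dominates_def by (meson left_divides_mult_left left_divides_trans)

lemma dominates_mult_left: "dominates S a b \<Longrightarrow> dominates S (c * a) (c * b)"
  unfolding dominates_def by (simp flip: mult.assoc)

lemma dominates_imp_left_divides: "dominates S a b \<Longrightarrow> s \<in> S \<Longrightarrow> s \<preceq>\<^sub>l b \<Longrightarrow> s \<preceq>\<^sub>l a"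
  unfolding dominates_def by (metis mult_1)

section \<open>Normal words and their first letters\<close>

lemma normal_word_Cons_Cons:
  "normal_word S (s # t # w) \<longleftrightarrow> s \<in> S \<and> normal_pair S s t \<and> normal_word S (t # w)"
  unfolding normal_word_def by auto

lemma normal_word_Nil [simp]: "normal_word S []"
  unfolding normal_word_def by simp

lemma normal_word_singleton [simp]: "normal_word S [s] \<longleftrightarrow> s \<in> S"
  unfolding normal_word_def by auto

lemma normal_word_ConsD: "normal_word S (s # w) \<Longrightarrow> s \<in> S \<and> normal_word S w"
  by (cases w) (auto simp: normal_word_Cons_Cons)

text \<open>Local normality becomes global: \<open>t\<close> dominates
  \<open>t * prod_list w\<close>, left multiplication by \<open>s\<close> preserves this, and
  \<open>s\<close> dominates \<open>s * t\<close>. Hence any element of \<open>S\<close>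
  left-dividing the product left-divides the first letter.\<close>

lemma normal_word_head_dominates:
  "normal_word S (s # w) \<Longrightarrow> dominates S s (s * prod_list w)"
proof (induction w arbitrary: s)
  case Nil
  then show ?case by simp
next
  case (Cons t w)
  then have "dominates S s (s * t)" "dominates S t (t * prod_list w)"
    by (auto simp: normal_word_Cons_Cons normal_pair_iff_dominates)
  then show ?case
    by (auto intro: dominates_trans dominates_mult_left)
qed

section \<open>Length-preserving rewriting sequences\<close>

text \<open>Models a length-preserving step. As \<open>k\<close> counts the letters before the
  rewritten pair, the prefix of length \<open>Suc k\<close> is the only one whose product may
  change.\<close>

definition swap_at :: "'a::monoid_mult set \<Rightarrow> nat \<Rightarrow> 'a list \<Rightarrow> 'a list \<Rightarrow> bool" where
  "swap_at S k x y \<longleftrightarrow>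
     (\<exists>u s t s' t' v. x = u @ [s, t] @ v \<and> y = u @ [s', t'] @ v \<and> length u = k \<and> s \<in> S \<and>
        s * t = s' * t' \<and> \<not> normal_pair S s t \<and> normal_pair S s' t')"

lemma swap_at_length: "swap_at S k x y \<Longrightarrow> length y = length x \<and> Suc k < length x"
  unfolding swap_at_def by auto

lemma swap_at_prefix_eq:
  assumes "swap_at S k x y" "i \<noteq> Suc k"
  shows "prod_list (take i x) = prod_list (take i y)"
proof -
  obtain u s t s' t' v where *: "x = u @ [s, t] @ v" "y = u @ [s', t'] @ v" "length u = k"
    "s * t = s' * t'"
    using assms(1) unfolding swap_at_def by blast
  consider "i \<le> k" | j where "i = k + Suc (Suc j)"
    using assms(2) by (metis add_Suc_right less_iff_Suc_add not_less_eq not_less nat_neq_iff add_Suc)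
  then show ?thesis
  proof cases
    case 1
    then show ?thesis using * by simp
  next
    case 2
    have "s * (t * z) = s' * (t' * z)" for z
      using *(4) by (metis mult.assoc)
    then show ?thesis using * 2 by simp
  qed
qed

text \<open>Since \<open>s\<close> lies in \<open>S\<close> and left-divides \<open>s' * t'\<close>,
  normality of the new pair gives \<open>s \<preceq>\<^sub>l s'\<close>. Both claims then follow on
  left multiplication by the product of \<open>u\<close>.\<close>

lemma swap_at_prefix_Suc:
  assumes "swap_at S k x y"
  shows "prod_list (take (Suc k) x) \<preceq>\<^sub>l prod_list (take (Suc k) y)"
    and "dominates S (prod_list (take (Suc k) y)) (prod_list (take (Suc (Suc k)) y))"
proof -
  obtain u s t s' t' v where *: "x = u @ [s, t] @ v" "y = u @ [s', t'] @ v" "length u = k"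
    "s * t = s' * t'" "s \<in> S" "dominates S s' (s' * t')"
    using assms unfolding swap_at_def normal_pair_iff_dominates by blast
  have "s \<preceq>\<^sub>l s' * t'"
    using *(4) by (metis left_divides_mult_right)
  then have "s \<preceq>\<^sub>l s'"
    using * dominates_imp_left_divides by blast
  then show "prod_list (take (Suc k) x) \<preceq>\<^sub>l prod_list (take (Suc k) y)"
    using * by (simp add: left_divides_mult_left)
  show "dominates S (prod_list (take (Suc k) y)) (prod_list (take (Suc (Suc k)) y))"
    using * by (simp add: dominates_mult_left)
qed

lemma swap_at_prefix_mono:
  assumes "swap_at S k x y"
  shows "prod_list (take i x) \<preceq>\<^sub>l prod_list (take i y)"
  by (metis assms left_divides_refl swap_at_prefix_Suc(1) swap_at_prefix_eq)

text \<open>If \<open>s\<close> dominated \<open>s'\<close>, it would by transitivity dominate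
  \<open>s' * t' = s * t\<close>, and the old pair would be normal. At position 0 the prefix product
  is the letter itself, with no left factor to restrict the multipliers \<open>f\<close>.\<close>

lemma swap_at_0_not_dominates:
  assumes "swap_at S 0 x y"
  shows "\<not> dominates S (prod_list (take 1 x)) (prod_list (take 1 y))"
proof -
  obtain s t s' t' v where *: "x = [s, t] @ v" "y = [s', t'] @ v"
    "s * t = s' * t'" "\<not> dominates S s (s * t)" "dominates S s' (s' * t')"
    using assms unfolding swap_at_def normal_pair_iff_dominates by auto
  then show ?thesis
    using dominates_trans by fastforce
qed

lemma swap_at_Suc_tl: "swap_at S (Suc k) x y \<Longrightarrow> swap_at S k (tl x) (tl y)"
  unfolding swap_at_def by (fastforce simp: length_Suc_conv)

lemma prefix_products_stabilise:
  fixes g :: "nat \<Rightarrow> 'a::monoid_mult list"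
  assumes step: "\<And>n. swap_at S (k n) (g n) (g (Suc n))"
    and len: "\<And>n. length (g n) = p"
    and "i \<le> p"
  shows "\<exists>N. \<forall>m\<ge>N. \<forall>n\<ge>N. dominates S (prod_list (take i (g m))) (prod_list (take i (g n)))"
  using \<open>i \<le> p\<close>
proof (induction rule: inc_induct)
  case base
  \<comment> \<open>The index \<open>p\<close> differs from \<open>Suc (k n)\<close>, which is
    smaller than the length, so the whole product never changes.\<close>
  have "prod_list (take p (g n)) = prod_list (take p (g (Suc n)))" for n
    using swap_at_prefix_eq[OF step] swap_at_length[OF step[of n]] len
    by (metis less_irrefl)
  then have "prod_list (take p (g n)) = prod_list (take p (g 0))" for n
    by (induction n) auto
  then show ?case
    by (metis dominates_refl)
next
  case (step i)
  define P where "P j n = prod_list (take j (g n))" for j n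
  have dom_later: "dominates S (P j n) (P j m)" if "m \<le> n" for j m n
    using that
  proof (induction rule: dec_induct)
    case base
    then show ?case by simp
  next
    case (step n)
    have "dominates S (P j (Suc n)) (P j n)"
      unfolding P_def using assms(1) swap_at_prefix_mono left_divides_imp_dominates by blast
    with step show ?case using dominates_trans by blast
  qed
  obtain N where N: "\<And>m n. m \<ge> N \<Longrightarrow> n \<ge> N \<Longrightarrow> dominates S (P (Suc i) m) (P (Suc i) n)"
    using step.IH unfolding P_def by blast
  show ?case
  \<comment> \<open>Either some step from \<open>N\<close> on may change the product of this prefix,
    or that product is constant from \<open>N\<close> on.\<close>
  proof (cases "\<exists>n\<ge>N. i = Suc (k n)")
    case True
    then obtain n0 where n0: "n0 \<ge> N" "i = Suc (k n0)" by blast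
    \<comment> \<open>With \<open>D j n\<close> the set of pairs for \<open>P j n\<close>, the chain
      below reads: \<open>D i n\<close> lies in \<open>D (Suc i) n\<close>, that in
      \<open>D (Suc i) (Suc n0)\<close>, that in \<open>D i (Suc n0)\<close>, and that in
      \<open>D i m\<close>. Once \<open>D i\<close> has caught up with the stable
      \<open>D (Suc i)\<close> it cannot grow.\<close>
    have "dominates S (P i m) (P i n)" if "m \<ge> Suc n0" "n \<ge> Suc n0" for m n
    proof -
      have "dominates S (P i m) (P i (Suc n0))"
        using dom_later that by blast
      moreover have "dominates S (P i (Suc n0)) (P (Suc i) (Suc n0))"
        unfolding P_def n0(2) by (rule swap_at_prefix_Suc(2)[OF assms(1)])
      moreover have "dominates S (P (Suc i) (Suc n0)) (P (Suc i) n)"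
        using N that n0 by simp
      moreover have "dominates S (P (Suc i) n) (P i n)"
        unfolding P_def by (intro left_divides_imp_dominates prod_list_take_left_divides) simp
      ultimately show ?thesis using dominates_trans by blast
    qed
    then show ?thesis unfolding P_def by blast
  next
    case False
    have "P i n = P i N" if "n \<ge> N" for n
      using that
    proof (induction rule: dec_induct)
      case (step n)
      then show ?case
        unfolding P_def using False swap_at_prefix_eq[OF assms(1)] by metis
    qed simp
    then show ?thesis unfolding P_def by (metis dominates_refl)
  qed
qed

text \<open>Induction on the common length: past the index where the first letter is stable up to
  domination no step occurs at position 0, so the tails form a sequence of the same kind.\<close>

lemma no_infinite_swap_sequence:
  fixes g :: "nat \<Rightarrow> 'a::monoid_mult list"
  assumes "\<And>n. swap_at S (k n) (g n) (g (Suc n))" and "\<And>n. length (g n) = p"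
  shows False
  using assms
proof (induction p arbitrary: g k)
  case 0
  then show ?case using swap_at_length by (metis not_less0)
next
  case (Suc p)
  obtain N where N: "\<And>m n. m \<ge> N \<Longrightarrow> n \<ge> N \<Longrightarrow>
      dominates S (prod_list (take 1 (g m))) (prod_list (take 1 (g n)))"
    using prefix_products_stabilise[where g=g and k=k and i=1, OF Suc.prems] by auto
  have pos: "k n \<noteq> 0" if "n \<ge> N" for n
    using swap_at_0_not_dominates[of S "g n" "g (Suc n)"] Suc.prems(1)[of n] N that
    by (metis le_SucI)
  show ?case
  proof (rule Suc.IH)
    show "swap_at S (k (N + n) - 1) (tl (g (N + n))) (tl (g (N + Suc n)))" for n
      using Suc.prems(1)[of "N + n"] pos[of "N + n"] by (intro swap_at_Suc_tl) simp
    show "length (tl (g (N + n))) = p" for n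
      using Suc.prems(2) by simp
  qed
qed

section \<open>Normal decompositions in left-cancellative monoids\<close>

locale garside =
  fixes S :: "'a::monoid_mult set"
  assumes left_cancellative: "left_cancellative TYPE('a)"
    and no_nontrivial_invertible: "no_nontrivial_invertible TYPE('a)"
    and garside_family: "garside_family S"
begin

lemma cancel_left: "f * g = f * h \<longleftrightarrow> g = (h::'a)"
  using left_cancellative unfolding left_cancellative_def by blast

text \<open>One-sided inverses are two-sided here: cancel \<open>f\<close> in
  \<open>f * (g * f) = f\<close>.\<close>

lemma mult_eq_one_iff: "f * g = 1 \<longleftrightarrow> f = 1 \<and> g = (1::'a)"
proof
  assume fg: "f * g = 1"
  then have "f * (g * f) = f * 1"
    by (simp flip: mult.assoc)
  then have "g * f = 1" using cancel_left by blast
  with fg show "f = 1 \<and> g = 1"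
    using no_nontrivial_invertible unfolding no_nontrivial_invertible_def by (metis mult_1)
qed simp

lemma left_divides_antisym: "a \<preceq>\<^sub>l b \<Longrightarrow> b \<preceq>\<^sub>l a \<Longrightarrow> a = (b::'a)"
  unfolding left_divides_def by (metis cancel_left mult.assoc mult.right_neutral mult_eq_one_iff)

lemma left_divides_one_iff: "a \<preceq>\<^sub>l (1::'a) \<longleftrightarrow> a = 1"
  using left_divides_antisym by auto

lemma prod_list_eq_one_iff: "prod_list w = (1::'a) \<longleftrightarrow> set w \<subseteq> {1}"
  by (induction w) (auto simp: mult_eq_one_iff)

text \<open>Each first letter lies in \<open>S\<close> and left-divides the common product, hence
  left-divides the other first letter.\<close>

lemma normal_word_head_eq:
  assumes "normal_word S (s # v)" "normal_word S (t # w)" "prod_list (s # v) = prod_list (t # w)"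
  shows "s = t"
proof -
  have "a \<preceq>\<^sub>l b" if "normal_word S (a # x)" "normal_word S (b # y)"
    "prod_list (a # x) = prod_list (b # y)" for a b x y
  proof (rule dominates_imp_left_divides)
    show "dominates S b (b * prod_list y)"
      using that normal_word_head_dominates by blast
    show "a \<in> S" using that normal_word_ConsD by blast
    show "a \<preceq>\<^sub>l b * prod_list y" using that(3) by (metis left_divides_mult_right prod_list.Cons)
  qed
  from this[OF assms] this[OF assms(2,1) assms(3)[symmetric]] show ?thesis
    by (rule left_divides_antisym)
qed

text \<open>The letter 1 is excluded because \<open>[]\<close> and \<open>[1]\<close> are both
  normal with product 1. Otherwise first letters agree and can be cancelled.\<close>

lemma normal_word_unique:
  assumes "normal_word S v" "normal_word S w" "1 \<notin> set v" "1 \<notin> set w"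
    "prod_list v = prod_list w"
  shows "v = w"
  using assms
proof (induction v arbitrary: w)
  case Nil
  then have "set w \<subseteq> {1}" by (metis prod_list.Nil prod_list_eq_one_iff)
  then show ?case using Nil by (cases w) auto
next
  case (Cons s v)
  have "w \<noteq> []"
    using Cons.prems(3,5) mult_eq_one_iff by auto
  then obtain t w' where w: "w = t # w'" by (cases w) auto
  then have "s = t" using Cons.prems normal_word_head_eq by blast
  then show ?case
    using Cons.IH[of w'] Cons.prems w normal_word_ConsD by (auto simp: cancel_left)
qed

text \<open>In a normal word only letters 1 can follow a letter 1, so the deletion cuts off a tail
  and creates no new adjacent pair.\<close>

lemma normal_word_removeAll_one:
  "normal_word S w \<Longrightarrow> normal_word S (removeAll 1 w)"
proof (induction w)
  case Nil
  then show ?case by simp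
next
  case (Cons s w)
  show ?case
  proof (cases "s = 1")
    case True
    with Cons show ?thesis using normal_word_ConsD by auto
  next
    case False
    have IH: "normal_word S (removeAll 1 w)"
      using Cons normal_word_ConsD by blast
    show ?thesis
    proof (cases w)
      case Nil
      then show ?thesis using Cons False by simp
    next
      case w: (Cons t w')
      show ?thesis
      proof (cases "t = 1")
        case False
        then show ?thesis
          using IH Cons.prems \<open>s \<noteq> 1\<close> w by (simp add: normal_word_Cons_Cons)
      next
        case True
        have "dominates S 1 (prod_list w')"
          using normal_word_head_dominates[of S t w'] Cons.prems w True
          by (simp add: normal_word_Cons_Cons)
        then have all: "x \<preceq>\<^sub>l prod_list w' \<Longrightarrow> x \<in> S \<Longrightarrow> x = 1" for x
          using dominates_imp_left_divides left_divides_one_iff by blast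
        \<comment> \<open>The first letter of \<open>w'\<close> other than 1 would be an element of
          \<open>S\<close> left-dividing \<open>prod_list w'\<close>.\<close>
        have "removeAll 1 w' = []"
        proof (rule ccontr)
          assume "removeAll 1 w' \<noteq> []"
          then obtain x y where xy: "removeAll 1 w' = x # y" by (cases "removeAll 1 w'") auto
          have "prod_list (removeAll 1 w') = prod_list w'" by (induction w') auto
          then have "x \<preceq>\<^sub>l prod_list w'" using xy by (metis left_divides_mult_right prod_list.Cons)
          moreover have "x \<in> S" using IH w True xy normal_word_ConsD by auto
          ultimately have "x = 1" using all by blast
          moreover have "x \<in> set (removeAll 1 w')" using xy by simp
          ultimately show False by simp
        qed
        then show ?thesis
          using w True \<open>s \<noteq> 1\<close> Cons.prems by (simp add: normal_word_Cons_Cons)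
      qed
    qed
  qed
qed

lemma prod_list_removeAll_one: "prod_list (removeAll (1::'a) w) = prod_list w"
  by (induction w) auto

lemma minimal_normal_decomposition_one_notin:
  assumes "minimal_normal_decomposition S g w"
  shows "1 \<notin> set w"
proof
  assume "1 \<in> set w"
  then have "length (removeAll 1 w) < length w"
    by (rule length_removeAll_less)
  moreover have "normal_decomposition S g (removeAll 1 w)"
    using assms normal_word_removeAll_one prod_list_removeAll_one
    unfolding minimal_normal_decomposition_def normal_decomposition_def by simp
  ultimately show False
    using assms unfolding minimal_normal_decomposition_def by fastforce
qed

lemma minimal_normal_decomposition_exists: "\<exists>w. minimal_normal_decomposition S g w"
proof -
  obtain v where "normal_decomposition S g v"
    using garside_family unfolding garside_family_def by blast
  then show ?thesis
    unfolding minimal_normal_decomposition_def by (rule ex_has_least_nat)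
qed

text \<open>Normality is used twice: \<open>s\<close> left-divides the first letter
  \<open>a\<close>, and then, after cancelling \<open>s\<close>, \<open>t\<close> left-divides
  \<open>a' * b\<close>. Nothing is left for a third letter, which must be 1.\<close>

lemma minimal_normal_decomposition_mult_length:
  assumes "s \<in> S" "t \<in> S" "minimal_normal_decomposition S (s * t) w"
  shows "length w \<le> 2"
proof (rule ccontr)
  assume "\<not> length w \<le> 2"
  then obtain a b c v where w: "w = a # b # c # v"
    by (metis One_nat_def Suc_1 Suc_leI le0 length_Cons list.exhaust list.size(3) not_le
        not_less_eq_eq)
  have norm: "normal_word S w" and prod: "a * (b * (c * prod_list v)) = s * t"
    using assms(3) w unfolding minimal_normal_decomposition_def normal_decomposition_def by auto
  have "s \<preceq>\<^sub>l a * prod_list (b # c # v)"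
    using prod by (metis left_divides_mult_right prod_list.Cons)
  then have "s \<preceq>\<^sub>l a"
    using norm w normal_word_head_dominates dominates_imp_left_divides assms(1) by blast
  then obtain a' where a': "a = s * a'" unfolding left_divides_def by blast
  then have t: "t = a' * (b * (c * prod_list v))"
    using prod by (simp add: mult.assoc cancel_left)
  \<comment> \<open>The cofactor \<open>a'\<close> serves as the left multiplier, although
    \<open>a'\<close> itself may lie outside \<open>S\<close>.\<close>
  have "dominates S (a' * b) (a' * (b * prod_list (c # v)))"
    using norm w normal_word_head_dominates dominates_mult_left normal_word_ConsD by blast
  then have "t \<preceq>\<^sub>l a' * b"
    using t assms(2) dominates_imp_left_divides by fastforce
  then obtain x where "a' * b = t * x" unfolding left_divides_def by metis
  then have "t * (x * (c * prod_list v)) = t * 1"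
    using t by (metis mult.assoc mult.right_neutral)
  then have "x * (c * prod_list v) = 1" using cancel_left by blast
  then have "c = 1" by (simp add: mult_eq_one_iff)
  then show False
    using minimal_normal_decomposition_one_notin[OF assms(3)] w by simp
qed

section \<open>The rewriting system\<close>

lemma garside_rulesE:
  assumes "(x, y) \<in> garside_rules S"
  obtains s t where "x = [s, t]" "s \<in> S" "t \<in> S" "\<not> normal_pair S s t"
    "normal_word S y" "1 \<notin> set y" "prod_list y = s * t" "length y \<le> 2"
proof -
  obtain s t where *: "x = [s, t]" "s \<in> S" "t \<in> S" "\<not> normal_word S [s, t]"
    "minimal_normal_decomposition S (s * t) y"
    using assms unfolding garside_rules_def by auto
  show ?thesis
  proof (rule that)
    show "\<not> normal_pair S s t" using * by (simp add: normal_word_Cons_Cons)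
    show "1 \<notin> set y" using * minimal_normal_decomposition_one_notin by blast
    show "length y \<le> 2" using * minimal_normal_decomposition_mult_length by blast
    show "normal_word S y" "prod_list y = s * t"
      using *(5) unfolding minimal_normal_decomposition_def normal_decomposition_def by auto
  qed (use * in auto)
qed

lemma rewriting_system_garside_rules: "rewriting_system (S - {1}) (garside_rules S)"
  unfolding rewriting_system_def
proof clarify
  fix x y assume xy: "(x, y) \<in> garside_rules S"
  then have "x \<in> lists (S - {1})" unfolding garside_rules_def by auto
  moreover have "y \<in> lists (S - {1})"
    using xy by (elim garside_rulesE) (auto simp: normal_word_def)
  ultimately show "x \<in> lists (S - {1}) \<and> y \<in> lists (S - {1})" ..
qed

abbreviation step :: "'a list \<Rightarrow> 'a list \<Rightarrow> bool" where
  "step \<equiv> rewrite_step (S - {1}) (garside_rules S)"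

lemma step_lists:
  assumes "step x y"
  shows "x \<in> lists (S - {1}) \<and> y \<in> lists (S - {1})"
  using assms
proof cases
  case (1 u v w w')
  then have "w \<in> lists (S - {1})" "w' \<in> lists (S - {1})"
    using rewriting_system_garside_rules unfolding rewriting_system_def by blast+
  with 1 show ?thesis by (simp only: append_in_lists_conv)
qed

lemma step_prod_list: "step x y \<Longrightarrow> prod_list y = prod_list x"
  by (elim rewrite_step.cases garside_rulesE) (simp add: mult.assoc)

lemma step_length: "step x y \<Longrightarrow> length y \<le> length x"
  by (auto elim!: rewrite_step.cases garside_rulesE)

lemma step_imp_swap_at:
  assumes "step x y" "length y = length x"
  shows "\<exists>k. swap_at S k x y"
  using assms(1)
proof cases
  case (1 u v w w')
  from \<open>(w, w') \<in> garside_rules S\<close> show ?thesis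
  proof (rule garside_rulesE)
    fix s t
    assume *: "w = [s, t]" "s \<in> S" "\<not> normal_pair S s t" "normal_word S w'" "prod_list w' = s * t"
    then have "length w' = 2" using assms(2) 1 by simp
    then obtain s' t' where w': "w' = [s', t']"
      by (auto simp: numeral_2_eq_2 length_Suc_conv)
    then have "s * t = s' * t'" "normal_pair S s' t'"
      using * by (auto simp: normal_word_Cons_Cons)
    then show ?thesis
      unfolding swap_at_def using 1 * w' by blast
  qed
qed

section \<open>Termination\<close>

lemma terminating_garside_rules: "terminating (S - {1}) (garside_rules S)"
  unfolding terminating_def
proof clarify
  fix f assume f: "\<forall>i. step (f i) (f (Suc i))"
  \<comment> \<open>The word at \<open>N\<close> has least length in the sequence; as lengths never
    increase, they are constant from \<open>N\<close> on.\<close>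
  obtain N where N: "\<And>n. length (f N) \<le> length (f n)"
    using ex_has_least_nat[of "\<lambda>_. True" 0 "\<lambda>n. length (f n)"] by blast
  have "length (f (N + n)) \<le> length (f N)" for n
    by (induction n) (use f step_length in \<open>auto intro: order_trans\<close>)
  then have len: "length (f (N + n)) = length (f N)" for n
    using N by (simp add: order_antisym)
  then have "\<exists>k. swap_at S k (f (N + n)) (f (N + Suc n))" for n
    using f step_imp_swap_at len by (metis add_Suc_right)
  then obtain k where "\<And>n. swap_at S (k n) (f (N + n)) (f (N + Suc n))"
    by metis
  then show False
    using len by (rule no_infinite_swap_sequence)
qed

section \<open>Normal forms and confluence\<close>

lemma not_normal_imp_step:
  assumes "x \<in> lists (S - {1})" "\<not> normal_word S x"
  shows "\<exists>y. step x y"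
proof -
  have "\<not> successively (normal_pair S) x"
    using assms unfolding normal_word_def by auto
  \<comment> \<open>The induction locates the first adjacent pair that fails to be normal.\<close>
  then have "\<exists>u s t v. x = u @ [s, t] @ v \<and> \<not> normal_pair S s t"
  proof (induction x)
    case Nil
    then show ?case by simp
  next
    case (Cons a x)
    then obtain b y where x: "x = b # y" by (cases x) auto
    show ?case
    proof (cases "normal_pair S a b")
      case True
      then obtain u s t v where "x = u @ [s, t] @ v" "\<not> normal_pair S s t"
        using Cons x by auto
      then show ?thesis by (metis append_Cons)
    next
      case False
      then show ?thesis using x by (metis append_Cons append_Nil)
    qed
  qed
  then obtain u s t v where x: "x = u @ [s, t] @ v" "\<not> normal_pair S s t" by blast
  obtain w where "minimal_normal_decomposition S (s * t) w"
    using minimal_normal_decomposition_exists by blast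
  then have "([s, t], w) \<in> garside_rules S"
    using x assms(1) unfolding garside_rules_def by (auto simp: normal_word_Cons_Cons)
  then show ?thesis
    using x assms(1) rewrite_step.intros[of u "S - {1}" v "[s, t]" w] by auto
qed

lemma wfP_step: "wfP (\<lambda>y x. step x y)"
  using terminating_garside_rules
  unfolding terminating_def wf_iff_no_infinite_down_chain[to_pred] by simp

lemma step_rtranclp_normal:
  assumes "x \<in> lists (S - {1})"
  shows "\<exists>y. step\<^sup>*\<^sup>* x y \<and> normal_word S y \<and> 1 \<notin> set y"
  using wfP_step assms
proof (induction x rule: wfp_induct_rule)
  case (less x)
  show ?case
  proof (cases "normal_word S x")
    case True
    then show ?thesis using less.prems by auto
  next
    case False
    then obtain y where "step x y" using not_normal_imp_step less.prems by blast
    then show ?thesis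
      using less.IH[of y] step_lists by (meson converse_rtranclp_into_rtranclp)
  qed
qed

text \<open>No critical pairs are examined: both words reduce to normal words without 1 that have
  the product of \<open>x\<close>, and these coincide by uniqueness.\<close>

lemma confluentp_step: "confluentp step"
proof (rule confluentpI)
  fix x y z assume xy: "step\<^sup>*\<^sup>* x y" and xz: "step\<^sup>*\<^sup>* x z"
  have inv: "prod_list b = prod_list a \<and> (a \<in> lists (S - {1}) \<longrightarrow> b \<in> lists (S - {1}))"
    if "step\<^sup>*\<^sup>* a b" for a b
    using that by induction (use step_lists step_prod_list in auto)
  show "\<exists>u. step\<^sup>*\<^sup>* y u \<and> step\<^sup>*\<^sup>* z u"
  proof (cases "x \<in> lists (S - {1})")
    case True
    then obtain y' z' where y': "step\<^sup>*\<^sup>* y y'" "normal_word S y'" "1 \<notin> set y'"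
      and z': "step\<^sup>*\<^sup>* z z'" "normal_word S z'" "1 \<notin> set z'"
      using step_rtranclp_normal inv xy xz by meson
    then have "y' = z'"
      using inv xy xz by (intro normal_word_unique) metis+
    then show ?thesis using y' z' by blast
  next
    case False
    \<comment> \<open>A list with a letter outside \<open>S - {1}\<close> takes no step, so both
      paths are empty.\<close>
    then have "y = x" "z = x"
      using xy xz step_lists by (metis converse_rtranclpE)+
    then show ?thesis by blast
  qed
qed

end

theorem proposition6p3p3:
  fixes S :: "'a::monoid_mult set"
  assumes "left_cancellative TYPE('a)"
    and "no_nontrivial_invertible TYPE('a)"
    and "garside_family S"
  shows "convergent_rewriting_system (S - {1}) (garside_rules S)"
proof -
  interpret garside S using assms by unfold_locales
  show ?thesis
    unfolding convergent_rewriting_system_def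
    using rewriting_system_garside_rules confluentp_step terminating_garside_rules by blast
qed

end
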